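(* For all complex numbers $\alpha$, $\lambda$ and all non-negative integers $\ell$, $n$, $r$, $s$, the following identity holds in $\mathbb{C}[x]$: $$\sum_{k=0}^{n+r}\lambda^{n+r-k}\binom{n+r}{k}\binom{\ell+k+r}{r}E_{\ell+k}^{(\alpha)}(x)+(-1)^{\ell+n+r+s+1}\sum_{k=0}^{\ell+r}\lambda^{\ell+r-k}\binom{\ell+r}{k}\binom{n+k+r}{r}E_{n+k}^{(\alpha)}(\alpha-s-\lambda-x)$$ $$=2\,\Psi_{\alpha-1}\left(\frac{D^{r}}{r!}\sum_{k=0}^{s-1}(-1)^{k}(x+k)^{\ell+r}(x+\lambda+k)^{n+r}\right).$$
   Context: For $\alpha\in\mathbb{C}$, the generalized Euler polynomials $E_n^{(\alpha)}(x)\in\mathbb{C}[x]$, $n\ge 0$, are defined by $\sum_{n=0}^{\infty}E_n^{(\alpha)}(x)\frac{t^n}{n!}=\left(\frac{2}{e^t+1}\right)^{\alpha}e^{tx}$, where the $\alpha$-th power denotes the formal power series in $t$ with constant term $1$. $\Psi_\alpha$ denotes the $\mathbb{C}$-linear automorphism of $\mathbb{C}[x]$ with $\Psi_\alpha(x^n)=E_n^{(\alpha)}(x)$ for all integers $n\ge 0$. $D$ denotes the derivation operator $d/dx$ on $\mathbb{C}[x]$, and $D^r$ its $r$-th iterate. An empty sum (the case $s=0$) is $0$, and $0^0=1$. *)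

theory Defs
  imports "HOL-Computational_Algebra.Computational_Algebra"
begin

text \<open>
  The formal power \<open>f ^ a = (1 + (f - 1)) ^ a\<close> of a power series with constant term 1,
  given by the binomial series; it is meaningful only if \<open>f $ 0 = 1\<close>.
\<close>
definition fps_cpow :: "complex fps \<Rightarrow> complex \<Rightarrow> complex fps" where
  "fps_cpow f a = fps_binomial a oo (f - 1)"

text \<open>
  Generating functions live in \<open>\<complex>[x][[t]]\<close>, i.e. in the type \<open>complex poly fps\<close>: the
  inner variable is \<open>x\<close> and the outer one is \<open>t\<close>.
\<close>
definition fps_lift_const :: "complex fps \<Rightarrow> complex poly fps" where
  "fps_lift_const f = Abs_fps (\<lambda>n. [:f $ n:])"

definition fps_exp_tx :: "complex poly fps" where
  "fps_exp_tx = Abs_fps (\<lambda>n. monom (1 / fact n) n)"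

definition gen_euler_gf :: "complex \<Rightarrow> complex poly fps" where
  "gen_euler_gf \<alpha> = fps_lift_const (fps_cpow (2 / (fps_exp 1 + 1)) \<alpha>) * fps_exp_tx"

definition gen_euler_poly :: "complex \<Rightarrow> nat \<Rightarrow> complex poly" where
  "gen_euler_poly \<alpha> n = smult (fact n) (gen_euler_gf \<alpha> $ n)"

definition Psi :: "complex \<Rightarrow> complex poly \<Rightarrow> complex poly" where
  "Psi \<alpha> p = (\<Sum>i\<le>degree p. smult (coeff p i) (gen_euler_poly \<alpha> i))"

lemma gen_euler_base_nth_0: "(2 / (fps_exp 1 + 1) :: complex fps) $ 0 = 1"
  by (simp add: fps_divide_unit)

lemma fps_cpow_nth_0: "fps_cpow f a $ 0 = 1"
  by (simp add: fps_cpow_def)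

lemma gen_euler_poly_gf: "Abs_fps (\<lambda>n. smult (1 / fact n) (gen_euler_poly \<alpha> n)) = gen_euler_gf \<alpha>"
  by (rule fps_ext) (simp add: gen_euler_poly_def)

lemma Psi_eq_sum:
  assumes "degree p \<le> N"
  shows "Psi \<alpha> p = (\<Sum>i\<le>N. smult (coeff p i) (gen_euler_poly \<alpha> i))"
  unfolding Psi_def using assms
  by (intro sum.mono_neutral_left) (auto simp: coeff_eq_0)

lemma Psi_add: "Psi \<alpha> (p + q) = Psi \<alpha> p + Psi \<alpha> q"
proof -
  let ?N = "max (degree p) (degree q)"
  have "degree (p + q) \<le> ?N" by (rule degree_add_le_max)
  then show ?thesis
    by (simp add: Psi_eq_sum[of _ ?N] smult_add_left sum.distrib)
qed

lemma Psi_smult: "Psi \<alpha> (smult c p) = smult c (Psi \<alpha> p)"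
  unfolding Psi_eq_sum[OF degree_smult_le, of \<alpha> c p] Psi_eq_sum[OF order_refl, of \<alpha> p]
  by (rule poly_eqI) (simp add: coeff_sum sum_distrib_left mult.assoc)

lemma Psi_monom: "Psi \<alpha> (monom 1 n) = gen_euler_poly \<alpha> n"
  by (simp add: Psi_eq_sum[of _ n] degree_monom_le if_distrib[where f = "\<lambda>c. smult c _"] cong: if_cong)

lemma coeff_gen_euler_poly:
  "coeff (gen_euler_poly \<alpha> n) i =
     (if i \<le> n then fact n / fact i * fps_cpow (2 / (fps_exp 1 + 1)) \<alpha> $ (n - i) else 0)"
proof -
  let ?f = "fps_cpow (2 / (fps_exp 1 + 1)) \<alpha>"
  have "gen_euler_gf \<alpha> $ n = (\<Sum>j\<le>n. monom (?f $ (n - j) / fact j) j)"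
    unfolding gen_euler_gf_def fps_mult_nth fps_lift_const_def fps_exp_tx_def
    by (subst sum.atLeastAtMost_rev) (simp add: atMost_atLeast0 smult_monom)
  then show ?thesis
    by (simp add: gen_euler_poly_def coeff_sum)
qed

lemma coeff_Psi_degree:
  assumes "degree p \<le> N"
  shows "coeff (Psi \<alpha> p) N = coeff p N"
proof -
  have "coeff (Psi \<alpha> p) N =
    (\<Sum>i\<le>N. if i = N then coeff p N * coeff (gen_euler_poly \<alpha> N) N else 0)"
    unfolding Psi_eq_sum[OF assms] coeff_sum
    by (intro sum.cong) (auto simp: coeff_gen_euler_poly)
  then show ?thesis
    by (simp add: coeff_gen_euler_poly fps_cpow_nth_0)
qed

lemma degree_Psi_le: "degree (Psi \<alpha> p) \<le> degree p"
  by (rule degree_le) (auto simp: Psi_def coeff_sum coeff_gen_euler_poly)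

lemma Psi_surj_aux: "degree q < N \<Longrightarrow> \<exists>p. Psi \<alpha> p = q"
proof (induction N arbitrary: q)
  case (Suc N)
  let ?m = "smult (coeff q N) (monom 1 N)"
  have deg: "degree ?m \<le> N"
    by (simp add: smult_monom degree_monom_le)
  have "degree (q - Psi \<alpha> ?m) \<le> N"
    using Suc.prems deg degree_Psi_le[of \<alpha> ?m]
    by (intro degree_diff_le) auto
  moreover have "coeff (q - Psi \<alpha> ?m) N = 0"
    using coeff_Psi_degree[OF deg, of \<alpha>] by simp
  ultimately have "degree (q - Psi \<alpha> ?m) < N \<or> q - Psi \<alpha> ?m = 0"
    by (metis leading_coeff_0_iff le_neq_implies_less)
  then obtain p where "Psi \<alpha> p = q - Psi \<alpha> ?m"
    using Suc.IH[of "q - Psi \<alpha> ?m"] by (metis Psi_smult smult_0_left)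
  then have "Psi \<alpha> (p + ?m) = q"
    by (simp add: Psi_add)
  then show ?case ..
qed simp

lemma Psi_bij: "bij (Psi \<alpha>)"
proof (rule bijI)
  show "inj (Psi \<alpha>)"
  proof (rule injI)
    fix p q assume "Psi \<alpha> p = Psi \<alpha> q"
    then have "Psi \<alpha> (p + smult (-1) q) = 0"
      unfolding Psi_add Psi_smult by simp
    then have "p + smult (-1) q = 0"
      using coeff_Psi_degree[OF order_refl, of \<alpha> "p + smult (-1) q"]
      by (metis coeff_0 leading_coeff_0_iff)
    then show "p = q" by simp
  qed
  show "surj (Psi \<alpha>)"
    unfolding surj_def using Psi_surj_aux by (metis lessI)
qed

end

theory Submission
  imports Defs
begin

text \<open>
  The map \<open>\<Psi>\<^sub>\<alpha>\<close> is the power series \<open>A\<^sub>\<alpha>(t) = (2 / (e\<^sup>t + 1))\<^sup>\<alpha>\<close> evaluated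
  at \<open>t = D\<close>. Since \<open>e\<^sup>c\<^sup>D\<close> is the translation by \<open>c\<close>, \<open>\<Psi>\<^sub>\<alpha>\<close> commutes with translations,
  the relation \<open>A\<^sub>\<alpha>(t) (1 + e\<^sup>t) = 2 A\<^bsub>\<alpha>-1\<^esub>(t)\<close> gives
  \<open>\<Psi>\<^sub>\<alpha>(p(x) + p(x + 1)) = 2 \<Psi>\<^bsub>\<alpha>-1\<^esub>(p)\<close>, and \<open>A\<^sub>\<alpha>(-t) = e\<^bsup>\<alpha>t\<^esup> A\<^sub>\<alpha>(t)\<close> gives
  the reflection formula for \<open>E\<^sub>n(\<alpha> - x)\<close>. Hence, with \<open>f = x\<^bsup>l+r\<^esup> (x + \<lambda>)\<^bsup>n+r\<^esup>\<close>, the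
  left-hand side is \<open>\<Psi>\<^sub>\<alpha>\<close> applied to \<open>D\<^sup>r/r! (f(x) - (-1)\<^sup>s f(x + s))\<close>, and the bracket is
  \<open>g(x) + g(x + 1)\<close> for the alternating sum \<open>g\<close> of the translates \<open>f(x + k)\<close>, \<open>k < s\<close>.
\<close>

section \<open>Linear operators, composition and higher derivatives on polynomials\<close>

lemma linear_poly_ext:
  fixes f g :: "'a::comm_semiring_1 poly \<Rightarrow> 'a poly"
  assumes "\<And>p q. f (p + q) = f p + f q" "\<And>c p. f (smult c p) = smult c (f p)"
    and "\<And>p q. g (p + q) = g p + g q" "\<And>c p. g (smult c p) = smult c (g p)"
    and "\<And>n. f (monom 1 n) = g (monom 1 n)"
  shows "f p = g p"
proof -
  have f0: "f 0 = 0" and g0: "g 0 = 0"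
    using assms(2)[of 0 0] assms(4)[of 0 0] by simp_all
  have "f (monom c n) = g (monom c n)" for c n
    using assms(2)[of c "monom 1 n"] assms(4)[of c "monom 1 n"] assms(5)[of n]
    by (simp add: smult_monom)
  then have "f (\<Sum>i\<in>A. monom (coeff p i) i) = g (\<Sum>i\<in>A. monom (coeff p i) i)" for A
    by (induction A rule: infinite_finite_induct) (simp_all add: f0 g0 assms(1,3))
  then show ?thesis
    by (metis poly_as_sum_of_monoms)
qed

lemma smult_sum_right: "smult c (\<Sum>i\<in>A. f i) = (\<Sum>i\<in>A. smult c (f i))"
  by (induction A rule: infinite_finite_induct) (simp_all add: smult_add_right)

text \<open>The final identity writes signs as polynomial factors, whereas the linearity lemmas
  expect scalars.\<close>

lemma neg_one_power_mult_poly: "(-1) ^ k * p = smult ((-1) ^ k) (p :: 'a::comm_ring_1 poly)"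
  by (cases "even k") simp_all

lemma pcompose_power: "(p ^ n) \<circ>\<^sub>p q = (p \<circ>\<^sub>p q) ^ n" for p q :: "'a::comm_semiring_1 poly"
  by (induction n) (simp_all add: pcompose_mult pcompose_1)

lemma higher_pderiv_pcompose_linear:
  fixes p :: "'a::field_char_0 poly"
  shows "(pderiv ^^ m) (p \<circ>\<^sub>p [:c, d:]) = smult (d ^ m) ((pderiv ^^ m) p \<circ>\<^sub>p [:c, d:])"
  by (induction m)
    (simp_all add: pderiv_smult pderiv_pcompose pderiv_pCons mult.commute)

lemma higher_pderiv_monom_fact:
  "(pderiv ^^ m) (monom (c::'a::field_char_0) n) =
     (if m \<le> n then monom (c * fact n / fact (n - m)) (n - m) else 0)"
proof (induction m)
  case (Suc m)
  show ?case
  proof (cases "Suc m \<le> n")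
    case True
    then obtain k where "n - m = Suc k" "n - Suc m = k"
      by (metis Suc_diff_Suc Suc_le_eq)
    with Suc True show ?thesis
      by (simp add: pderiv_monom field_simps del: of_nat_Suc)
  next
    case False
    then show ?thesis
      by (cases "m = n") (use Suc in \<open>simp_all add: pderiv_monom\<close>)
  qed
qed simp

lemma pcompose_monom_1: "monom 1 m \<circ>\<^sub>p q = (q :: 'a::comm_semiring_1 poly) ^ m"
  by (simp add: monom_altdef pcompose_power pcompose_pCons)

subsection \<open>Power series in the derivation\<close>

text \<open>This is the operator \<open>F(D)\<close>; the sum may stop at \<open>degree p\<close>
  because all higher derivatives of \<open>p\<close> vanish.\<close>

definition deriv_series :: "'a::field_char_0 fps \<Rightarrow> 'a poly \<Rightarrow> 'a poly" where
  "deriv_series F p = (\<Sum>j\<le>degree p. smult (F $ j) ((pderiv ^^ j) p))"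

lemma higher_pderiv_eq_0:
  fixes p :: "'a::field_char_0 poly"
  assumes "degree p < m"
  shows "(pderiv ^^ m) p = 0"
  by (rule poly_eqI) (use assms in \<open>simp add: coeff_higher_pderiv coeff_eq_0\<close>)

lemma deriv_series_eq_sum:
  assumes "degree p \<le> N"
  shows "deriv_series F p = (\<Sum>j\<le>N. smult (F $ j) ((pderiv ^^ j) p))"
  unfolding deriv_series_def using assms
  by (intro sum.mono_neutral_left) (auto simp: higher_pderiv_eq_0)

lemma deriv_series_add: "deriv_series F (p + q) = deriv_series F p + deriv_series F q"
proof -
  let ?N = "max (degree p) (degree q)"
  have "degree (p + q) \<le> ?N" by (rule degree_add_le_max)
  then show ?thesis
    by (simp add: deriv_series_eq_sum[of _ ?N] higher_pderiv_add smult_add_right sum.distrib)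
qed

lemma deriv_series_smult: "deriv_series F (smult c p) = smult c (deriv_series F p)"
  unfolding deriv_series_eq_sum[OF degree_smult_le, of F c p] deriv_series_eq_sum[OF order_refl, of F p]
  by (simp add: higher_pderiv_smult smult_sum_right mult.commute)

lemma deriv_series_fps_add: "deriv_series (F + G) p = deriv_series F p + deriv_series G p"
  by (simp add: deriv_series_def smult_add_left sum.distrib)

lemma deriv_series_fps_const_mult: "deriv_series (fps_const c * F) p = smult c (deriv_series F p)"
  by (simp add: deriv_series_def smult_sum_right)

lemma deriv_series_mult: "deriv_series (F * G) p = deriv_series F (deriv_series G p)"
proof -
  let ?N = "degree p"
  let ?t = "\<lambda>i j. smult (F $ i * G $ j) ((pderiv ^^ (i + j)) p)"
  have "degree (deriv_series G p) \<le> ?N"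
    unfolding deriv_series_def
    by (intro degree_sum_le) (auto simp: degree_higher_pderiv intro: order_trans[OF degree_smult_le])
  then have "deriv_series F (deriv_series G p) =
      (\<Sum>i\<le>?N. smult (F $ i) ((pderiv ^^ i) (\<Sum>j\<le>?N. smult (G $ j) ((pderiv ^^ j) p))))"
    by (subst deriv_series_eq_sum[of _ ?N]) (simp_all add: deriv_series_def[of G])
  also have "\<dots> = (\<Sum>i\<le>?N. \<Sum>j\<le>?N. ?t i j)"
    by (simp add: higher_pderiv_sum higher_pderiv_smult smult_sum_right funpow_add)
  also have "\<dots> = (\<Sum>(i, j)\<in>{..?N} \<times> {..?N}. ?t i j)"
    by (simp add: sum.cartesian_product)
  \<comment> \<open>Pairs with \<open>i + j > degree p\<close> contribute zero, so the square
    shrinks to the triangle of the Cauchy product.\<close>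
  also have "\<dots> = (\<Sum>(i, j)\<in>{(i, j). i + j \<le> ?N}. ?t i j)"
    by (intro sum.mono_neutral_right) (auto, metis higher_pderiv_eq_0 linorder_not_le)
  also have "\<dots> = (\<Sum>k\<le>?N. \<Sum>i\<le>k. ?t i (k - i))"
    by (rule sum.triangle_reindex_eq)
  also have "\<dots> = deriv_series (F * G) p"
    by (simp add: deriv_series_def fps_mult_nth atMost_atLeast0 smult_sum)
  finally show ?thesis ..
qed

text \<open>Taylor's formula: by linearity only monomials matter, and there it is the binomial
  theorem.\<close>

lemma deriv_series_exp: "deriv_series (fps_exp c) p = p \<circ>\<^sub>p [:c, 1:]"
proof (rule linear_poly_ext[where f = "deriv_series (fps_exp c)"])
  fix n
  have "deriv_series (fps_exp c) (monom 1 n) =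
      (\<Sum>j\<le>n. smult (of_nat (n choose j) * c ^ j) (monom 1 (n - j)))"
    by (simp add: deriv_series_def degree_monom_eq higher_pderiv_monom_fact smult_monom
        binomial_fact mult.commute)
  also have "\<dots> = (\<Sum>j\<le>n. of_nat (n choose j) * [:c:] ^ j * monom 1 1 ^ (n - j))"
    by (intro sum.cong)
      (simp_all add: monom_power poly_const_pow of_nat_poly ac_simps)
  also have "\<dots> = ([:c:] + monom 1 1) ^ n"
    by (rule binomial_ring[symmetric])
  also have "[:c:] + monom 1 1 = [:c, 1:]"
    by (simp add: monom_Suc)
  also have "[:c, 1:] ^ n = monom 1 n \<circ>\<^sub>p [:c, 1:]"
    by (simp add: pcompose_monom_1)
  finally show "deriv_series (fps_exp c) (monom 1 n) = monom 1 n \<circ>\<^sub>p [:c, 1:]" .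
qed (simp_all add: deriv_series_add deriv_series_smult pcompose_add pcompose_smult)

text \<open>Translation is itself a series in \<open>D\<close>, and multiplication of series is
  commutative.\<close>

lemma deriv_series_translate:
  "deriv_series F (p \<circ>\<^sub>p [:c, 1:]) = deriv_series F p \<circ>\<^sub>p [:c, 1:]"
  by (metis deriv_series_exp deriv_series_mult mult.commute)

text \<open>Each differentiation of \<open>p(-x)\<close> yields a factor -1, which is absorbed by
  passing from \<open>F(t)\<close> to \<open>F(-t)\<close>.\<close>

lemma deriv_series_reflect:
  "deriv_series F (p \<circ>\<^sub>p [:0, -1:]) = deriv_series (F oo - fps_X) p \<circ>\<^sub>p [:0, -1:]"
  by (simp add: deriv_series_def degree_pcompose higher_pderiv_pcompose_linear fps_compose_uminus'
      pcompose_sum pcompose_smult mult.commute)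

subsection \<open>Complex powers of power series\<close>

lemma fps_cpow_add:
  assumes "f $ 0 = 1"
  shows "fps_cpow f (a + b) = fps_cpow f a * fps_cpow f b"
  using assms by (simp add: fps_cpow_def fps_binomial_add_mult fps_compose_mult_distrib)

lemma fps_cpow_0: "fps_cpow f 0 = 1"
  by (simp add: fps_cpow_def)

lemma fps_cpow_1: "f $ 0 = 1 \<Longrightarrow> fps_cpow f 1 = f"
  by (simp add: fps_cpow_def fps_binomial_1 fps_compose_add_distrib)

text \<open>The binomial series \<open>B\<close> satisfies \<open>(1 + X) B' = a B\<close>;
  substituting \<open>f - 1\<close> for \<open>X\<close> and using the chain rule gives the
  claim.\<close>

lemma fps_deriv_cpow:
  assumes "f $ 0 = 1"
  shows "fps_deriv (fps_cpow f a) * f = fps_const a * fps_deriv f * fps_cpow f a"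
proof -
  let ?B = "fps_binomial a"
  have f0: "(f - 1) $ 0 = 0" using assms by simp
  have "fps_deriv ?B * (1 + fps_X) = fps_const a * ?B"
    by (simp add: fps_binomial_deriv fps_divide_unit mult.assoc inverse_mult_eq_1)
  then have "(fps_deriv ?B * (1 + fps_X)) oo (f - 1) = (fps_const a * ?B) oo (f - 1)"
    by simp
  then have "(fps_deriv ?B oo (f - 1)) * f = fps_const a * fps_cpow f a"
    using assms by (simp add: fps_compose_mult_distrib fps_compose_add_distrib fps_cpow_def)
  then show ?thesis
    by (simp add: fps_cpow_def fps_compose_deriv[OF f0] algebra_simps)
qed

text \<open>The product of \<open>h\<close> with the power of exponent \<open>-a\<close> has
  derivative 0 and constant term 1, hence equals 1. Laws for powers thus reduce to checking a
  differential equation.\<close>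

lemma fps_cpow_unique:
  assumes f0: "f $ 0 = 1" and h0: "h $ 0 = 1"
    and ode: "fps_deriv h * f = fps_const a * fps_deriv f * h"
  shows "h = fps_cpow f a"
proof -
  let ?g = "fps_cpow f (- a)"
  have "fps_deriv (h * ?g) * f = (fps_deriv h * f) * ?g + h * (fps_deriv ?g * f)"
    by (simp add: algebra_simps)
  also have "\<dots> = 0"
    unfolding ode fps_deriv_cpow[OF f0] by (simp flip: fps_const_neg)
  finally have "fps_deriv (h * ?g) = 0"
    using f0 by auto
  then have "h * ?g = 1"
    using h0 by (simp only: fps_deriv_eq_0_iff) (simp add: fps_cpow_nth_0)
  moreover have "?g * fps_cpow f a = 1"
    using fps_cpow_add[OF f0, of "- a" a] by (simp add: fps_cpow_0)
  ultimately show ?thesis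
    by (metis mult.assoc mult.left_neutral mult.right_neutral)
qed

lemma fps_cpow_mult:
  assumes f0: "f $ 0 = 1" and g0: "g $ 0 = 1"
  shows "fps_cpow (f * g) a = fps_cpow f a * fps_cpow g a"
proof (rule fps_cpow_unique[symmetric])
  let ?F = "fps_cpow f a" and ?G = "fps_cpow g a"
  have "fps_deriv (?F * ?G) * (f * g) =
      (fps_deriv ?F * f) * (?G * g) + (?F * f) * (fps_deriv ?G * g)"
    by (simp add: algebra_simps)
  also have "\<dots> = fps_const a * fps_deriv (f * g) * (?F * ?G)"
    unfolding fps_deriv_cpow[OF f0] fps_deriv_cpow[OF g0] by (simp add: algebra_simps)
  finally show "fps_deriv (?F * ?G) * (f * g) = fps_const a * fps_deriv (f * g) * (?F * ?G)" .
qed (simp_all add: f0 g0 fps_cpow_nth_0)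

lemma fps_cpow_exp: "fps_cpow (fps_exp 1) a = fps_exp a"
  by (rule fps_cpow_unique[symmetric]) simp_all

lemma fps_cpow_compose_uminus_X:
  assumes "f $ 0 = 1"
  shows "fps_cpow f a oo - fps_X = fps_cpow (f oo - fps_X) a"
  using assms
  by (simp add: fps_cpow_def fps_compose_sub_distrib flip: fps_compose_assoc)

subsection \<open>The generating function of the generalized Euler polynomials\<close>

abbreviation euler_base :: "complex fps" where
  "euler_base \<equiv> 2 / (fps_exp 1 + 1)"

lemma euler_base_mult: "euler_base * (1 + fps_exp 1) = 2"
proof -
  have "euler_base * (fps_exp 1 + 1) = 2"
    by (simp add: fps_divide_unit mult.assoc inverse_mult_eq_1)
  then show ?thesis
    by (simp only: add.commute)
qed

lemma euler_base_reflect: "euler_base oo - fps_X = fps_exp 1 * euler_base"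
proof -
  let ?R = "euler_base oo - fps_X"
  have "?R * (1 + fps_exp (-1)) = ?R * ((1 + fps_exp 1) oo - fps_X)"
    by (simp only: fps_compose_add_distrib fps_fps_exp_compose_minus fps_compose_1)
  also have "\<dots> = (euler_base * (1 + fps_exp 1)) oo - fps_X"
    by (rule fps_compose_mult_distrib[symmetric]) simp
  also have "\<dots> = 2"
    unfolding euler_base_mult by simp
  finally have R: "?R * (1 + fps_exp (-1)) = 2" .
  have "1 + fps_exp 1 = fps_exp 1 * (1 + fps_exp (-1) :: complex fps)"
    by (simp add: distrib_left flip: fps_exp_add_mult)
  then have "?R * (1 + fps_exp 1) = fps_exp 1 * (?R * (1 + fps_exp (-1)))"
    by simp
  also have "\<dots> = fps_exp 1 * euler_base * (1 + fps_exp 1)"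
    unfolding R by (simp only: mult.assoc euler_base_mult)
  \<comment> \<open>The factor \<open>1 + fps_exp 1\<close> can be cancelled: it is nonzero, since
    its product with \<open>euler_base\<close> is 2.\<close>
  finally show ?thesis
    by (metis euler_base_mult mult_right_cancel mult_zero_right zero_neq_numeral)
qed

text \<open>One factor \<open>euler_base\<close> splits off the power and meets
  \<open>1 + fps_exp 1\<close>, leaving 2.\<close>

lemma euler_cpow_mult:
  "fps_cpow euler_base \<alpha> * (1 + fps_exp 1) = fps_const 2 * fps_cpow euler_base (\<alpha> - 1)"
proof -
  have "fps_cpow euler_base \<alpha> = fps_cpow euler_base (\<alpha> - 1) * euler_base"
    using fps_cpow_add[OF gen_euler_base_nth_0, of "\<alpha> - 1" 1]
    by (simp add: fps_cpow_1[OF gen_euler_base_nth_0])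
  then show ?thesis
    by (simp only: mult.assoc euler_base_mult) (simp add: numeral_fps_const mult.commute)
qed

text \<open>The base picks up \<open>fps_exp 1\<close> under reflection, and the \<alpha>-th power
  of that factor is \<open>fps_exp \<alpha>\<close>.\<close>

lemma euler_cpow_reflect:
  "fps_cpow euler_base \<alpha> oo - fps_X = fps_exp \<alpha> * fps_cpow euler_base \<alpha>"
  by (simp only: fps_cpow_compose_uminus_X[OF gen_euler_base_nth_0] euler_base_reflect
      fps_cpow_mult[OF _ gen_euler_base_nth_0] fps_exp_nth power_0 fact_0 of_nat_1 div_by_1
      fps_cpow_exp)

subsection \<open>Properties of Psi\<close>

lemma Psi_eq_deriv_series: "Psi \<alpha> p = deriv_series (fps_cpow euler_base \<alpha>) p"
proof (rule linear_poly_ext[where f = "Psi \<alpha>"])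
  fix n
  let ?F = "fps_cpow euler_base \<alpha>"
  have "coeff (deriv_series ?F (monom 1 n)) i = coeff (gen_euler_poly \<alpha> n) i" for i
  proof -
    \<comment> \<open>Only the derivative of order \<open>n - i\<close> reaches degree
      \<open>i\<close>. The guard \<open>i \<le> n\<close> matters: truncated subtraction would
      otherwise select \<open>j = 0\<close>.\<close>
    have "coeff (deriv_series ?F (monom 1 n)) i =
        (\<Sum>j\<le>n. if i \<le> n \<and> j = n - i then fact n / fact i * ?F $ (n - i) else 0)"
      by (auto simp: deriv_series_def degree_monom_eq higher_pderiv_monom_fact coeff_sum
          intro!: sum.cong)
    then show ?thesis
      by (cases "i \<le> n") (simp_all add: coeff_gen_euler_poly)
  qed
  then show "Psi \<alpha> (monom 1 n) = deriv_series ?F (monom 1 n)"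
    by (simp add: Psi_monom poly_eqI)
qed (simp_all add: deriv_series_add deriv_series_smult Psi_add Psi_smult)

lemma Psi_translate: "Psi \<alpha> (p \<circ>\<^sub>p [:c, 1:]) = Psi \<alpha> p \<circ>\<^sub>p [:c, 1:]"
  by (simp add: Psi_eq_deriv_series deriv_series_translate)

lemma Psi_sum: "Psi \<alpha> (\<Sum>i\<in>A. f i) = (\<Sum>i\<in>A. Psi \<alpha> (f i))"
  by (induction A rule: infinite_finite_induct) (simp_all add: Psi_add Psi_def[of _ 0])

lemma Psi_add_translate: "Psi \<alpha> (p + p \<circ>\<^sub>p [:1, 1:]) = smult 2 (Psi (\<alpha> - 1) p)"
proof -
  have "Psi \<alpha> (p + p \<circ>\<^sub>p [:1, 1:]) =
      deriv_series (fps_cpow euler_base \<alpha>) (deriv_series (1 + fps_exp 1) p)"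
    \<comment> \<open>The instance \<open>c = 0\<close> says that the series 1 acts as the
      identity.\<close>
    using deriv_series_exp[of 0 p]
    by (simp add: Psi_eq_deriv_series deriv_series_fps_add deriv_series_exp)
  also have "\<dots> = smult 2 (Psi (\<alpha> - 1) p)"
    by (simp only: euler_cpow_mult deriv_series_fps_const_mult Psi_eq_deriv_series
        flip: deriv_series_mult)
  finally show ?thesis .
qed

lemma gen_euler_poly_reflect:
  "gen_euler_poly \<alpha> m \<circ>\<^sub>p [:\<alpha>, -1:] = smult ((-1) ^ m) (gen_euler_poly \<alpha> m)"
proof -
  let ?F = "fps_cpow euler_base \<alpha>" and ?x = "monom 1 m :: complex poly"
  \<comment> \<open>The substitution of \<alpha> - x is split into a translation by \<alpha> and a
    reflection; the translation turns \<open>F(D)\<close> into \<open>F(-D)\<close>.\<close>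
  have "gen_euler_poly \<alpha> m \<circ>\<^sub>p [:\<alpha>, -1:] = (deriv_series ?F ?x \<circ>\<^sub>p [:\<alpha>, 1:]) \<circ>\<^sub>p [:0, -1:]"
    by (simp add: pcompose_pCons Psi_eq_deriv_series flip: pcompose_assoc Psi_monom)
  also have "\<dots> = deriv_series (?F oo - fps_X) ?x \<circ>\<^sub>p [:0, -1:]"
    by (simp only: euler_cpow_reflect deriv_series_mult deriv_series_exp)
  also have "\<dots> = deriv_series ?F (?x \<circ>\<^sub>p [:0, -1:])"
    by (rule deriv_series_reflect[symmetric])
  also have "?x \<circ>\<^sub>p [:0, -1:] = smult ((-1) ^ m) ?x"
  proof -
    have "[:0, -1:] = monom (-1 :: complex) 1"
      by (simp add: monom_altdef)
    then show ?thesis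
      by (simp only: pcompose_monom_1) (simp add: monom_power smult_monom)
  qed
  finally show ?thesis
    by (simp add: deriv_series_smult flip: Psi_monom Psi_eq_deriv_series)
qed

lemma gen_euler_poly_reflect_translate:
  "gen_euler_poly \<alpha> m \<circ>\<^sub>p [:\<alpha> - c, -1:] = smult ((-1) ^ m) (gen_euler_poly \<alpha> m \<circ>\<^sub>p [:c, 1:])"
proof -
  have "gen_euler_poly \<alpha> m \<circ>\<^sub>p [:\<alpha> - c, -1:] = (gen_euler_poly \<alpha> m \<circ>\<^sub>p [:\<alpha>, -1:]) \<circ>\<^sub>p [:c, 1:]"
    by (simp add: pcompose_pCons flip: pcompose_assoc)
  then show ?thesis
    by (simp add: gen_euler_poly_reflect pcompose_smult)
qed

section \<open>Binomial sums as derivatives, and the alternating sum of translates\<close>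

text \<open>After expanding the power of \<open>[:c, 1:]\<close>, the operator
  \<open>D^r / r!\<close> produces the second binomial coefficient from each monomial of degree
  \<open>l + k + r\<close>.\<close>

lemma binomial_sum_eq_higher_pderiv:
  fixes c :: "'a::field_char_0"
  shows "(\<Sum>k=0..m. smult (c ^ (m - k) * of_nat (m choose k) * of_nat ((l + k + r) choose r))
            (monom 1 (l + k)))
    = smult (1 / fact r) ((pderiv ^^ r) (monom 1 (l + r) * [:c, 1:] ^ m))"
proof -
  have "[:c, 1:] = monom 1 1 + [:c:]"
    by (simp add: monom_Suc)
  then have "[:c, 1:] ^ m = (\<Sum>k\<le>m. of_nat (m choose k) * monom 1 1 ^ k * [:c:] ^ (m - k))"
    by (simp only: binomial_ring)
  also have "\<dots> = (\<Sum>k=0..m. smult (c ^ (m - k) * of_nat (m choose k)) (monom 1 k))"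
    by (intro sum.cong) (auto simp: monom_power poly_const_pow of_nat_poly ac_simps)
  finally have "monom 1 (l + r) * [:c, 1:] ^ m =
      (\<Sum>k=0..m. smult (c ^ (m - k) * of_nat (m choose k)) (monom 1 (l + k + r)))"
    by (simp add: sum_distrib_left mult_monom ac_simps)
  then show ?thesis
    by (auto simp: higher_pderiv_sum higher_pderiv_smult higher_pderiv_monom_fact smult_sum_right smult_monom
        binomial_fact intro!: sum.cong)
qed

lemma Psi_binomial_sum:
  "(\<Sum>k=0..m. smult (c ^ (m - k) * of_nat (m choose k) * of_nat ((l + k + r) choose r))
       (gen_euler_poly \<alpha> (l + k)))
    = Psi \<alpha> (smult (1 / fact r) ((pderiv ^^ r) (monom 1 (l + r) * [:c, 1:] ^ m)))"
  by (simp add: Psi_sum Psi_smult Psi_monom flip: binomial_sum_eq_higher_pderiv)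

text \<open>Translation by 1 sends each summand of \<open>g\<close> to the negative of the next one,
  so only the two ends survive.\<close>

lemma alternating_translates_telescope:
  fixes f :: "'a::comm_ring_1 poly" and s :: nat
  defines "g \<equiv> \<Sum>k<s. smult ((-1) ^ k) (f \<circ>\<^sub>p [:of_nat k, 1:])"
  shows "g + g \<circ>\<^sub>p [:1, 1:] = f - smult ((-1) ^ s) (f \<circ>\<^sub>p [:of_nat s, 1:])"
proof -
  have "g \<circ>\<^sub>p [:1, 1:] = (\<Sum>k<s. smult ((-1) ^ k) (f \<circ>\<^sub>p [:of_nat (Suc k), 1:]))"
    by (simp add: g_def pcompose_sum pcompose_smult pcompose_pCons add.commute flip: pcompose_assoc)
  then have "g + g \<circ>\<^sub>p [:1, 1:] = (\<Sum>k<s. smult ((-1) ^ k) (f \<circ>\<^sub>p [:of_nat k, 1:])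
      - smult ((-1) ^ Suc k) (f \<circ>\<^sub>p [:of_nat (Suc k), 1:]))"
    by (simp add: g_def sum.distrib)
  also have "\<dots> = f - smult ((-1) ^ s) (f \<circ>\<^sub>p [:of_nat s, 1:])"
    by (subst sum_lessThan_telescope') simp
  finally show ?thesis .
qed

theorem theorem3:
  fixes \<alpha> lam :: complex and l n r s :: nat
  shows
    "(\<Sum>k=0..n+r. smult (lam ^ (n + r - k) * of_nat ((n + r) choose k) * of_nat ((l + k + r) choose r))
        (gen_euler_poly \<alpha> (l + k)))
     + (-1) ^ (l + n + r + s + 1) *
       (\<Sum>k=0..l+r. smult (lam ^ (l + r - k) * of_nat ((l + r) choose k) * of_nat ((n + k + r) choose r))
          (gen_euler_poly \<alpha> (n + k) \<circ>\<^sub>p [:\<alpha> - of_nat s - lam, -1:]))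
     = 2 * Psi (\<alpha> - 1) (smult (1 / fact r) ((pderiv ^^ r)
         (\<Sum>k<s. (-1) ^ k * [:of_nat k, 1:] ^ (l + r) * [:lam + of_nat k, 1:] ^ (n + r))))"
proof -
  define f where "f = monom 1 (l + r) * [:lam, 1:] ^ (n + r)"
  define g where "g = (\<Sum>k<s. smult ((-1) ^ k) (f \<circ>\<^sub>p [:of_nat k, 1:]))"
  let ?D = "\<lambda>p :: complex poly. smult (1 / fact r) ((pderiv ^^ r) p)"
  have f_translate: "f \<circ>\<^sub>p [:c, 1:] = [:c, 1:] ^ (l + r) * [:lam + c, 1:] ^ (n + r)" for c
    by (simp add: f_def pcompose_mult pcompose_power pcompose_pCons pcompose_monom_1)
  have D_translate: "?D (p \<circ>\<^sub>p [:c, 1:]) = ?D p \<circ>\<^sub>p [:c, 1:]" for p c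
    by (simp add: higher_pderiv_pcompose_linear pcompose_smult)
  have D_diff: "?D (p - smult c q) = ?D p + smult (- c) (?D q)" for p q c
  proof -
    have "p - smult c q = p + smult (- c) q"
      by simp
    then show ?thesis
      by (simp only: higher_pderiv_add higher_pderiv_smult smult_add_right smult_smult mult.commute)
  qed
  \<comment> \<open>Reflecting the Euler polynomial of index \<open>n + k\<close> gives the sign
    \<open>(-1) ^ (n + k)\<close>. Replacing \<open>lam\<close> by \<open>- lam\<close> supplies
    \<open>(-1) ^ (l + r - k)\<close>, which makes the total sign independent of
    \<open>k\<close>.\<close>
  have sign: "lam ^ (l + r - k) * b * d * (-1) ^ (n + k)
      = (-1) ^ (l + n + r) * ((- lam) ^ (l + r - k) * b * d)" if "k \<le> l + r" for k and b d :: complex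
  proof -
    have split: "(-1) ^ (l + n + r) = (-1 :: complex) ^ (l + r - k) * (-1) ^ (n + k)"
      using that by (simp add: algebra_simps flip: power_add)
    have "(-1) ^ (l + r - k) * (- lam) ^ (l + r - k) = lam ^ (l + r - k)"
      by (simp flip: power_mult_distrib)
    then have "lam ^ (l + r - k) * b * d * (-1) ^ (n + k)
        = (-1) ^ (l + r - k) * (- lam) ^ (l + r - k) * b * d * (-1) ^ (n + k)"
      by simp
    then show ?thesis
      unfolding split by (simp only: mult_ac)
  qed
  have "(\<Sum>k=0..l+r. smult (lam ^ (l + r - k) * of_nat ((l + r) choose k) * of_nat ((n + k + r) choose r))
          (gen_euler_poly \<alpha> (n + k) \<circ>\<^sub>p [:\<alpha> - of_nat s - lam, -1:]))
      = smult ((-1) ^ (l + n + r)) ((\<Sum>k=0..l+r. smult ((- lam) ^ (l + r - k) * of_nat ((l + r) choose k)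
          * of_nat ((n + k + r) choose r)) (gen_euler_poly \<alpha> (n + k))) \<circ>\<^sub>p [:of_nat s + lam, 1:])"
    unfolding diff_diff_eq
    by (auto simp: gen_euler_poly_reflect_translate sign pcompose_sum pcompose_smult smult_sum_right
        intro!: sum.cong)
  also have "\<dots> = smult ((-1) ^ (l + n + r)) (Psi \<alpha> (?D (f \<circ>\<^sub>p [:of_nat s, 1:])))"
  proof -
    \<comment> \<open>The translation by \<open>s + lam\<close> turns \<open>x\<close> into
      \<open>x + s + lam\<close> and \<open>x - lam\<close> into \<open>x + s\<close>, so the
      factors trade places and \<open>f\<close> reappears, shifted by \<open>s\<close>.\<close>
    have "(monom 1 (n + r) * [:- lam, 1:] ^ (l + r)) \<circ>\<^sub>p [:of_nat s + lam, 1:] = f \<circ>\<^sub>p [:of_nat s, 1:]"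
      by (simp add: f_translate pcompose_mult pcompose_power pcompose_pCons pcompose_monom_1 ac_simps)
    then show ?thesis
      by (simp only: Psi_binomial_sum flip: Psi_translate D_translate)
  qed
  finally have second: "(\<Sum>k=0..l+r. smult (lam ^ (l + r - k) * of_nat ((l + r) choose k)
        * of_nat ((n + k + r) choose r)) (gen_euler_poly \<alpha> (n + k) \<circ>\<^sub>p [:\<alpha> - of_nat s - lam, -1:]))
      = smult ((-1) ^ (l + n + r)) (Psi \<alpha> (?D (f \<circ>\<^sub>p [:of_nat s, 1:])))" .
  \<comment> \<open>With \<open>m = l + n + r\<close>, the prefactor and the reflection sign combine
    to the coefficient of the upper end of the telescoping sum.\<close>
  have "(-1) ^ (m + s + 1) * (-1) ^ m = - ((-1) ^ s :: complex)" for m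
    by (induction m) simp_all
  then have "Psi \<alpha> (?D f) + (-1) ^ (l + n + r + s + 1) *
        smult ((-1) ^ (l + n + r)) (Psi \<alpha> (?D (f \<circ>\<^sub>p [:of_nat s, 1:])))
      = Psi \<alpha> (?D (f - smult ((-1) ^ s) (f \<circ>\<^sub>p [:of_nat s, 1:])))"
    by (simp only: neg_one_power_mult_poly smult_smult D_diff Psi_add Psi_smult flip: mult.assoc)
  also have "\<dots> = Psi \<alpha> (?D g + ?D g \<circ>\<^sub>p [:1, 1:])"
    unfolding g_def alternating_translates_telescope[symmetric]
    by (simp only: higher_pderiv_add smult_add_right flip: D_translate)
  also have "\<dots> = 2 * Psi (\<alpha> - 1) (?D g)"
    by (simp add: Psi_add_translate numeral_poly)
  also have "g = (\<Sum>k<s. (-1) ^ k * [:of_nat k, 1:] ^ (l + r) * [:lam + of_nat k, 1:] ^ (n + r))"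
    by (simp add: g_def f_translate neg_one_power_mult_poly mult.assoc)
  finally show ?thesis
    unfolding second Psi_binomial_sum f_def .
qed

end
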